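(* Let $\alpha>0$ and let $\mathbf R\subseteq[m]$ be a random set. Then $\mathbf R$ controls the familywise error rate at level $\alpha$, i.e. $\mathrm P(\mathbf R\cap N_{\mathrm P}\ne\emptyset)\le\alpha$ for every $\mathrm P\in M$, if and only if there exists an e-collection $\mathbf E$ such that $\mathbf R\subseteq R^{\mathrm{FWER}}_\alpha(\mathbf E)$. Moreover, the e-collection can be chosen so that every $\mathbf e_S$ takes values in $\{0,\alpha^{-1}\}$.
   Context: Setting: $M$ is a set of probability measures on a measurable space; $m\ge 1$, $[m]=\{1,\dots,m\}$; hypotheses $H_1,\dots,H_m$ are subsets of $M$; for $\mathrm P\in M$, $N_{\mathrm P}=\{i\in[m]:\mathrm P\in H_i\}$. Random variables and random sets (values in $2^{[m]}$) are measurable functions on this space; inequalities and inclusions between random objects are understood to hold $\mathrm P$-almost surely for every $\mathrm P\in M$. An e-collection is a family $\mathbf E=(\mathbf e_S)_{S\in 2^{[m]}}$ of nonnegative random variables with $\mathbb E_{\mathrm P}(\mathbf e_{N_{\mathrm P}})\le 1$ for all $\mathrm P\in M$; by convention $\mathbf e_\emptyset=0$. For an e-collection $\mathbf E$ let $\mathcal R^{\mathrm{FWER}}_\alpha(\mathbf E)=\{R\in 2^{[m]}:\mathbf e_S\ge \mathbf 1\{|R\cap S|>0\}/\alpha\ \text{for all }S\in 2^{[m]}\}$, and let $R^{\mathrm{FWER}}_\alpha(\mathbf E)$ be the largest set in $\mathcal R^{\mathrm{FWER}}_\alpha(\mathbf E)$; it exists and equals the union of all sets in $\mathcal R^{\mathrm{FWER}}_\alpha(\mathbf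 E)$. *)

theory Defs
  imports "HOL-Probability.Probability"
begin

definition true_hyps :: "nat \<Rightarrow> (nat \<Rightarrow> 'a measure set) \<Rightarrow> 'a measure \<Rightarrow> nat set" where
  "true_hyps m H P = {i \<in> {1..m}. P \<in> H i}"

(* \<Omega> only serves as the underlying measurable space; its measure is irrelevant.
   The expectation is taken as a nonnegative integral, since the Bochner integral of a
   non-integrable function would be 0. *)
definition e_collection ::
  "'a measure \<Rightarrow> 'a measure set \<Rightarrow> nat \<Rightarrow> (nat \<Rightarrow> 'a measure set) \<Rightarrow> (nat set \<Rightarrow> 'a \<Rightarrow> real) \<Rightarrow> bool" where
  "e_collection \<Omega> M m H E \<longleftrightarrow>
     (\<forall>S\<in>Pow {1..m}. E S \<in> borel_measurable \<Omega> \<and> (\<forall>\<omega>\<in>space \<Omega>. 0 \<le> E S \<omega>)) \<and>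
     (\<forall>\<omega>\<in>space \<Omega>. E {} \<omega> = 0) \<and>
     (\<forall>P\<in>M. (\<integral>\<^sup>+ \<omega>. ennreal (E (true_hyps m H P) \<omega>) \<partial>P) \<le> 1)"

(* Here e is the realization of an e-collection at one sample point. *)
definition fwer_sets :: "nat \<Rightarrow> real \<Rightarrow> (nat set \<Rightarrow> real) \<Rightarrow> nat set set" where
  "fwer_sets m \<alpha> e =
     {R \<in> Pow {1..m}. \<forall>S\<in>Pow {1..m}. e S \<ge> of_bool (card (R \<inter> S) > 0) / \<alpha>}"

definition R_FWER :: "nat \<Rightarrow> real \<Rightarrow> (nat set \<Rightarrow> real) \<Rightarrow> nat set" where
  "R_FWER m \<alpha> e = (GREATEST R. R \<in> fwer_sets m \<alpha> e)"

lemma R_FWER_greatest: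
  assumes "\<And>S. S \<subseteq> {1..m} \<Longrightarrow> 0 \<le> e S"
  shows "R_FWER m \<alpha> e \<in> fwer_sets m \<alpha> e"
    and "R_FWER m \<alpha> e = \<Union> (fwer_sets m \<alpha> e)"
proof -
  let ?U = "\<Union> (fwer_sets m \<alpha> e)"
  have sub: "?U \<subseteq> {1..m}"
    by (auto simp: fwer_sets_def)
  have "of_bool (card (?U \<inter> S) > 0) / \<alpha> \<le> e S" if S: "S \<subseteq> {1..m}" for S
  proof (cases "card (?U \<inter> S) > 0")
    case False
    then show ?thesis using assms[OF S] by simp
  next
    case True
    then have "?U \<inter> S \<noteq> {}" by (metis card.empty less_irrefl)
    then obtain R where R: "R \<in> fwer_sets m \<alpha> e" "R \<inter> S \<noteq> {}" by blast
    have "finite (R \<inter> S)" using S finite_subset by blast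
    then have "card (R \<inter> S) > 0" using R(2) by (simp add: card_gt_0_iff)
    moreover have "of_bool (card (R \<inter> S) > 0) / \<alpha> \<le> e S"
      using R(1) S by (auto simp: fwer_sets_def)
    ultimately show ?thesis using True by simp
  qed
  then have U: "?U \<in> fwer_sets m \<alpha> e"
    using sub by (simp add: fwer_sets_def)
  show eq: "R_FWER m \<alpha> e = ?U"
    unfolding R_FWER_def by (rule Greatest_equality) (use U in blast)+
  show "R_FWER m \<alpha> e \<in> fwer_sets m \<alpha> e"
    using U eq by simp
qed

definition controls_FWER ::
  "'a measure set \<Rightarrow> nat \<Rightarrow> (nat \<Rightarrow> 'a measure set) \<Rightarrow> real \<Rightarrow> ('a \<Rightarrow> nat set) \<Rightarrow> bool" where
  "controls_FWER M m H \<alpha> R \<longleftrightarrow>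
     (\<forall>P\<in>M. measure P {\<omega> \<in> space P. R \<omega> \<inter> true_hyps m H P \<noteq> {}} \<le> \<alpha>)"

(* Inclusions between random sets are meant almost surely under every P in M. *)
definition as_subset ::
  "'a measure set \<Rightarrow> ('a \<Rightarrow> nat set) \<Rightarrow> ('a \<Rightarrow> nat set) \<Rightarrow> bool" where
  "as_subset M A B \<longleftrightarrow> (\<forall>P\<in>M. AE \<omega> in P. A \<omega> \<subseteq> B \<omega>)"

end

(* For the forward direction take e_S = 1{R \<inter> S \<noteq> {}} / \<alpha>: then R itself belongs to the family whose
   largest set is R_FWER, and the expectation of e_N is the familywise error rate divided by \<alpha>.
   Conversely, if R is contained in R_FWER, then 1{R \<inter> N \<noteq> {}} \<le> \<alpha> e_N almost surely (Markov's
   inequality), and taking expectations bounds the familywise error rate by \<alpha>. *)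
theory Submission
  imports Defs
begin

lemma true_hyps_subset: "true_hyps m H P \<subseteq> {1..m}"
  by (auto simp: true_hyps_def)

text \<open>The target \<sigma>-algebra is discrete, so every condition on the value of
  \<open>R\<close> is the preimage of a measurable set; this makes the familywise error an
  event.\<close>

lemma sets_hits:
  assumes R: "R \<in> measurable \<Omega> (count_space A)"
  shows "{\<omega> \<in> space \<Omega>. R \<omega> \<inter> S \<noteq> {}} \<in> sets \<Omega>"
proof -
  have "R -` {T \<in> A. T \<inter> S \<noteq> {}} \<inter> space \<Omega> \<in> sets \<Omega>"
    by (rule measurable_sets[OF R]) auto
  also have "R -` {T \<in> A. T \<inter> S \<noteq> {}} \<inter> space \<Omega> = {\<omega> \<in> space \<Omega>. R \<omega> \<inter> S \<noteq> {}}"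
    using measurable_space[OF R] by auto
  finally show ?thesis .
qed

text \<open>With these values \<open>T\<close> meets the constraint at every \<open>S\<close> with
  equality, hence is one of the sets whose union is \<open>R_FWER\<close>.\<close>

lemma subset_R_FWER:
  assumes "\<alpha> > 0" "T \<subseteq> {1..m}"
  shows "T \<subseteq> R_FWER m \<alpha> (\<lambda>S. of_bool (T \<inter> S \<noteq> {}) / \<alpha>)"
proof -
  have "T \<in> fwer_sets m \<alpha> (\<lambda>S. of_bool (T \<inter> S \<noteq> {}) / \<alpha>)"
    using assms by (auto simp: fwer_sets_def card_gt_0_iff)
  then show ?thesis
    using assms(1) by (subst R_FWER_greatest(2)) auto
qed

text \<open>Pointwise core of the Markov argument: the largest set is itself a member of the family,
  so its own constraint at \<open>S\<close> can be invoked once a subset \<open>T\<close> hits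
  \<open>S\<close>.\<close>

lemma R_FWER_hits_ge:
  assumes nonneg: "\<And>S. S \<subseteq> {1..m} \<Longrightarrow> 0 \<le> e S"
    and S: "S \<subseteq> {1..m}" and "T \<subseteq> R_FWER m \<alpha> e" "T \<inter> S \<noteq> {}"
  shows "1 / \<alpha> \<le> e S"
proof -
  let ?U = "R_FWER m \<alpha> e"
  have "?U \<in> fwer_sets m \<alpha> e"
    using nonneg by (rule R_FWER_greatest(1))
  then have "of_bool (card (?U \<inter> S) > 0) / \<alpha> \<le> e S"
    using S by (auto simp: fwer_sets_def)
  \<comment> \<open>Finiteness of \<open>S\<close> matters: \<open>card\<close> of an infinite set
    would be 0.\<close>
  moreover have "card (?U \<inter> S) > 0"
    using assms(3,4) finite_subset[OF S] by (auto simp: card_gt_0_iff)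
  ultimately show ?thesis by simp
qed

lemma e_collection_if_controls_FWER:
  assumes M: "\<And>P. P \<in> M \<Longrightarrow> prob_space P \<and> sets P = sets \<Omega>"
    and "\<alpha> > 0"
    and R: "R \<in> measurable \<Omega> (count_space (Pow {1..m}))"
    and ctrl: "controls_FWER M m H \<alpha> R"
  shows "e_collection \<Omega> M m H (\<lambda>S \<omega>. of_bool (R \<omega> \<inter> S \<noteq> {}) / \<alpha>)"
  unfolding e_collection_def
proof (intro conjI ballI)
  fix S assume "S \<in> Pow {1..m}"
  have "Measurable.pred \<Omega> (\<lambda>\<omega>. R \<omega> \<inter> S \<noteq> {})"
    unfolding pred_def by (rule sets_hits[OF R])
  then show "(\<lambda>\<omega>. of_bool (R \<omega> \<inter> S \<noteq> {}) / \<alpha>) \<in> borel_measurable \<Omega>"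
    unfolding of_bool_def by measurable
next
  fix P assume P: "P \<in> M"
  then interpret prob_space P using M by blast
  have sets: "sets P = sets \<Omega>" using M P by blast
  then have space: "space P = space \<Omega>" by (rule sets_eq_imp_space_eq)
  let ?N = "true_hyps m H P"
  let ?A = "{\<omega> \<in> space P. R \<omega> \<inter> ?N \<noteq> {}}"
  have A: "?A \<in> sets P"
    unfolding sets space by (rule sets_hits[OF R])
  have "(\<integral>\<^sup>+ \<omega>. ennreal (of_bool (R \<omega> \<inter> ?N \<noteq> {}) / \<alpha>) \<partial>P)
      = (\<integral>\<^sup>+ \<omega>. ennreal (1 / \<alpha>) * indicator ?A \<omega> \<partial>P)"
    by (rule nn_integral_cong) (auto simp: indicator_def)
  also have "\<dots> = ennreal (1 / \<alpha> * prob ?A)"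
    using A \<open>\<alpha> > 0\<close> by (simp add: nn_integral_cmult_indicator emeasure_eq_measure flip: ennreal_mult)
  \<comment> \<open>The normalization 1/\<alpha> turns the error bound \<alpha> into the expectation
    bound 1.\<close>
  also have "\<dots> \<le> 1"
    using ctrl P \<open>\<alpha> > 0\<close> by (auto simp: controls_FWER_def divide_simps)
  finally show "(\<integral>\<^sup>+ \<omega>. ennreal (of_bool (R \<omega> \<inter> ?N \<noteq> {}) / \<alpha>) \<partial>P) \<le> 1" .
\<comment> \<open>What remains is nonnegativity and the convention for the empty index, which holds
  because no set meets \<open>{}\<close>.\<close>
qed (use \<open>\<alpha> > 0\<close> in auto)

lemma controls_FWER_if_e_collection:
  assumes M: "\<And>P. P \<in> M \<Longrightarrow> prob_space P \<and> sets P = sets \<Omega>"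
    and "\<alpha> > 0"
    and R: "R \<in> measurable \<Omega> (count_space (Pow {1..m}))"
    and E: "e_collection \<Omega> M m H E"
    and sub: "as_subset M R (\<lambda>\<omega>. R_FWER m \<alpha> (\<lambda>S. E S \<omega>))"
  shows "controls_FWER M m H \<alpha> R"
  unfolding controls_FWER_def
proof (intro ballI)
  fix P assume P: "P \<in> M"
  then interpret prob_space P using M by blast
  have sets [measurable_cong]: "sets P = sets \<Omega>" using M P by blast
  then have space: "space P = space \<Omega>" by (rule sets_eq_imp_space_eq)
  let ?N = "true_hyps m H P"
  let ?A = "{\<omega> \<in> space P. R \<omega> \<inter> ?N \<noteq> {}}"
  have A: "?A \<in> sets P"
    unfolding sets space by (rule sets_hits[OF R])
  have EN [measurable]: "E ?N \<in> borel_measurable \<Omega>"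
    using E true_hyps_subset unfolding e_collection_def by blast
  have "AE \<omega> in P. R \<omega> \<subseteq> R_FWER m \<alpha> (\<lambda>S. E S \<omega>)"
    using sub P by (auto simp: as_subset_def)
  \<comment> \<open>The inclusion is known only almost surely, hence so is this bound; that suffices
    for comparing integrals. Products are taken in \<open>ennreal\<close> so that \<alpha> can be
    pulled out without integrability.\<close>
  then have "AE \<omega> in P. indicator ?A \<omega> \<le> ennreal \<alpha> * ennreal (E ?N \<omega>)"
  proof (rule AE_mp, intro AE_I2 impI)
    fix \<omega> assume \<omega>: "\<omega> \<in> space P" and incl: "R \<omega> \<subseteq> R_FWER m \<alpha> (\<lambda>S. E S \<omega>)"
    have nonneg: "0 \<le> E S \<omega>" if "S \<subseteq> {1..m}" for S
      using E that \<omega> space by (auto simp: e_collection_def)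
    have "1 \<le> \<alpha> * E ?N \<omega>" if "R \<omega> \<inter> ?N \<noteq> {}"
      using R_FWER_hits_ge[OF nonneg true_hyps_subset incl that] \<open>\<alpha> > 0\<close>
      by (simp add: divide_simps mult.commute)
    \<comment> \<open>Outside \<open>?A\<close> the left side is 0, so only sample points with a
      false rejection need the bound above.\<close>
    then have "indicator ?A \<omega> \<le> ennreal (\<alpha> * E ?N \<omega>)"
      by (cases "\<omega> \<in> ?A") auto
    also have "\<dots> = ennreal \<alpha> * ennreal (E ?N \<omega>)"
      using \<open>\<alpha> > 0\<close> nonneg[OF true_hyps_subset] by (intro ennreal_mult) auto
    finally show "indicator ?A \<omega> \<le> ennreal \<alpha> * ennreal (E ?N \<omega>)" .
  qed
  then have "(\<integral>\<^sup>+ \<omega>. indicator ?A \<omega> \<partial>P) \<le> (\<integral>\<^sup>+ \<omega>. ennreal \<alpha> * ennreal (E ?N \<omega>) \<partial>P)"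
    by (rule nn_integral_mono_AE)
  also have "\<dots> = ennreal \<alpha> * (\<integral>\<^sup>+ \<omega>. ennreal (E ?N \<omega>) \<partial>P)"
    by (rule nn_integral_cmult) measurable
  also have "\<dots> \<le> ennreal \<alpha> * 1"
    using E P by (intro mult_left_mono) (auto simp: e_collection_def)
  finally show "prob ?A \<le> \<alpha>"
    using A \<open>\<alpha> > 0\<close> by (simp add: emeasure_eq_measure)
qed

theorem theorem12:
  fixes \<Omega> :: "'a measure" and M :: "'a measure set" and m :: nat
    and H :: "nat \<Rightarrow> 'a measure set" and \<alpha> :: real and R :: "'a \<Rightarrow> nat set"
  assumes "m \<ge> 1"
    and "\<And>P. P \<in> M \<Longrightarrow> prob_space P \<and> sets P = sets \<Omega>"
    and "\<And>i. i \<in> {1..m} \<Longrightarrow> H i \<subseteq> M"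
    and "\<alpha> > 0"
    and "R \<in> measurable \<Omega> (count_space (Pow {1..m}))"
  shows "(controls_FWER M m H \<alpha> R \<longleftrightarrow>
           (\<exists>E. e_collection \<Omega> M m H E \<and>
                as_subset M R (\<lambda>\<omega>. R_FWER m \<alpha> (\<lambda>S. E S \<omega>)))) \<and>
         (controls_FWER M m H \<alpha> R \<longrightarrow>
           (\<exists>E. e_collection \<Omega> M m H E \<and>
                as_subset M R (\<lambda>\<omega>. R_FWER m \<alpha> (\<lambda>S. E S \<omega>)) \<and>
                (\<forall>S\<in>Pow {1..m}. \<forall>\<omega>\<in>space \<Omega>. E S \<omega> \<in> {0, 1 / \<alpha>})))"
proof -
  let ?E = "\<lambda>S \<omega>. of_bool (R \<omega> \<inter> S \<noteq> {}) / \<alpha>"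
  \<comment> \<open>For this witness the inclusion holds at every sample point; error control enters
    through the expectation bound.\<close>
  have "AE \<omega> in P. R \<omega> \<subseteq> R_FWER m \<alpha> (\<lambda>S. ?E S \<omega>)" if "P \<in> M" for P
  proof (rule AE_I2)
    fix \<omega> assume "\<omega> \<in> space P"
    then have "\<omega> \<in> space \<Omega>"
      using assms(2)[OF that] sets_eq_imp_space_eq by blast
    then have "R \<omega> \<subseteq> {1..m}"
      using measurable_space[OF assms(5)] by auto
    then show "R \<omega> \<subseteq> R_FWER m \<alpha> (\<lambda>S. ?E S \<omega>)"
      by (rule subset_R_FWER[OF assms(4)])
  qed
  then have sub: "as_subset M R (\<lambda>\<omega>. R_FWER m \<alpha> (\<lambda>S. ?E S \<omega>))"
    by (simp add: as_subset_def)
  \<comment> \<open>Proved with the two-valued clause included, so that it gives the final claim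
    directly and the existence half of the equivalence by dropping that clause.\<close>
  have fwd: "controls_FWER M m H \<alpha> R \<longrightarrow>
      (\<exists>E. e_collection \<Omega> M m H E \<and>
           as_subset M R (\<lambda>\<omega>. R_FWER m \<alpha> (\<lambda>S. E S \<omega>)) \<and>
           (\<forall>S\<in>Pow {1..m}. \<forall>\<omega>\<in>space \<Omega>. E S \<omega> \<in> {0, 1 / \<alpha>}))"
    using e_collection_if_controls_FWER[OF assms(2,4,5)] sub
    by (intro impI exI[of _ ?E]) auto
  then show ?thesis
    using controls_FWER_if_e_collection[OF assms(2,4,5)] by blast
qed

end
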